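(* Let $\hat{C}=(\hat{V},\hat{N},\hat{P})$ be an abstract component with layout $\mathit{C}$. Then the algorithm Abstract-C, run on $\hat{C}$, always terminates (for every choice of the nodes and edges selected in its loops).
   Context: An abstract component with layout $\mathit{C}$ (cycle) is a directed graph $(\hat{V},\hat{N},\hat{P})$ with $\hat{V}$ a finite set of variables, $\hat{N}$ a finite set of nodes and $\hat{P}\subseteq(\hat{V}\times\hat{N})\cup(\hat{N}\times\hat{N})$. For $n\in\hat{N}$ let $P_{in}(\{n\})=\{(x,n)\in\hat{P}\mid x\in\hat{N}\setminus\{n\}\}$ and $P_{out}(\{n\})=\{(n,x)\in\hat{P}\mid x\in\hat{N}\setminus\{n\}\}$. A node $n$ is special if $(v,n)\in\hat{P}$ for some $v\in\hat{V}$, or $|P_{in}(\{n\})|>1$, or $|P_{out}(\{n\})|>1$; otherwise it is ordinary. Algorithm Abstract-C: (1) $M\leftarrow$ the set of ordinary nodes of $\hat{N}$; (2) while there are $a,b\in M$ with $a\neq b$ and $(a,b)\in\hat{P}$: (i) while there exists $(b,c)\in\hat{P}$: $\hat{P}\leftarrow(\hat{P}\setminus\{(b,c)\})\cup\{(a,c)\}$; (ii) $\hat{N}\leftarrow\hat{N}\setminus\{b\}$; (iii) $\hat{P}\leftarrow(\hat{P}\setminus\{(a,b)\})\cup\{(a,a)\}$; (iv) $M\leftarrow M\setminus\{b\}$; (3) return $(\hat{V},\hat{N},\hat{P})$. *)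

theory Defs
  imports Main
begin

text \<open>
  Variables and nodes are drawn from one common universe \<open>'a\<close>. Disjointness of the variable
  set and the node set is not required.
\<close>

locale abstract_component_C =
  fixes V :: "'a set" and N :: "'a set" and P :: "('a \<times> 'a) set"
  assumes finite_variables: "finite V"
    and finite_nodes: "finite N"
    and edges: "P \<subseteq> (V \<times> N) \<union> (N \<times> N)"

definition P_in :: "'a set \<Rightarrow> ('a \<times> 'a) set \<Rightarrow> 'a \<Rightarrow> ('a \<times> 'a) set" where
  "P_in N P n = {(x, n) | x. (x, n) \<in> P \<and> x \<in> N - {n}}"

definition P_out :: "'a set \<Rightarrow> ('a \<times> 'a) set \<Rightarrow> 'a \<Rightarrow> ('a \<times> 'a) set" where
  "P_out N P n = {(n, x) | x. (n, x) \<in> P \<and> x \<in> N - {n}}"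

definition special :: "'a set \<Rightarrow> 'a set \<Rightarrow> ('a \<times> 'a) set \<Rightarrow> 'a \<Rightarrow> bool" where
  "special V N P n \<longleftrightarrow>
     (\<exists>v\<in>V. (v, n) \<in> P) \<or> card (P_in N P n) > 1 \<or> card (P_out N P n) > 1"

definition ordinary_nodes :: "'a set \<Rightarrow> 'a set \<Rightarrow> ('a \<times> 'a) set \<Rightarrow> 'a set" where
  "ordinary_nodes V N P = {n \<in> N. \<not> special V N P n}"

text \<open>
  The algorithm as a nondeterministic small-step transition system. A configuration consists
  of a program point and the current values of the program variables, in the order \<open>V\<close>, \<open>N\<close>,
  \<open>P\<close>, \<open>M\<close>, and then, inside the body of the outer loop, the selected pair \<open>a\<close>, \<open>b\<close>.
  \<open>Inner\<close> is the head of the inner loop (i); \<open>Remove_Node\<close>, \<open>Contract_Edge\<close> and \<open>Unmark\<close> are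
  the points immediately before the assignments (ii), (iii) and (iv).
\<close>

datatype 'a config =
    Start "'a set" "'a set" "('a \<times> 'a) set"
  | Outer "'a set" "'a set" "('a \<times> 'a) set" "'a set"
  | Inner "'a set" "'a set" "('a \<times> 'a) set" "'a set" 'a 'a
  | Remove_Node "'a set" "'a set" "('a \<times> 'a) set" "'a set" 'a 'a
  | Contract_Edge "'a set" "'a set" "('a \<times> 'a) set" "'a set" 'a 'a
  | Unmark "'a set" "'a set" "('a \<times> 'a) set" "'a set" 'a 'a
  | Return "'a set" "'a set" "('a \<times> 'a) set"

inductive abstract_C_step :: "'a config \<Rightarrow> 'a config \<Rightarrow> bool" where
  init:
    "abstract_C_step (Start V N P) (Outer V N P (ordinary_nodes V N P))"
| outer_enter:
    "\<lbrakk>a \<in> M; b \<in> M; a \<noteq> b; (a, b) \<in> P\<rbrakk> \<Longrightarrow>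
     abstract_C_step (Outer V N P M) (Inner V N P M a b)"
| outer_exit:
    "\<not> (\<exists>a\<in>M. \<exists>b\<in>M. a \<noteq> b \<and> (a, b) \<in> P) \<Longrightarrow>
     abstract_C_step (Outer V N P M) (Return V N P)"
| inner_iterate:
    "(b, c) \<in> P \<Longrightarrow>
     abstract_C_step (Inner V N P M a b) (Inner V N ((P - {(b, c)}) \<union> {(a, c)}) M a b)"
| inner_exit:
    "\<not> (\<exists>c. (b, c) \<in> P) \<Longrightarrow>
     abstract_C_step (Inner V N P M a b) (Remove_Node V N P M a b)"
| remove_node:
    "abstract_C_step (Remove_Node V N P M a b) (Contract_Edge V (N - {b}) P M a b)"
| contract_edge:
    "abstract_C_step (Contract_Edge V N P M a b)
       (Unmark V N ((P - {(a, b)}) \<union> {(a, a)}) M a b)"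
| unmark:
    "abstract_C_step (Unmark V N P M a b) (Outer V N P (M - {b}))"

fun returned :: "'a config \<Rightarrow> bool" where
  "returned (Return V N P) = True"
| "returned _ = False"

text \<open>
  Termination under every resolution of the nondeterminism: there is no infinite execution,
  and an execution that cannot be continued has reached a final configuration, so that being
  stuck does not count as terminating.
\<close>

definition always_terminates :: "('s \<Rightarrow> 's \<Rightarrow> bool) \<Rightarrow> ('s \<Rightarrow> bool) \<Rightarrow> 's \<Rightarrow> bool" where
  "always_terminates step final s \<longleftrightarrow>
     \<not> (\<exists>f :: nat \<Rightarrow> 's. f 0 = s \<and> (\<forall>i. step (f i) (f (Suc i)))) \<and>
     (\<forall>t. step\<^sup>*\<^sup>* s t \<and> \<not> (\<exists>u. step t u) \<longrightarrow> final t)"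

end

theory Submission
  imports Defs
begin

text \<open>
  Every pass through the outer loop unmarks one node of the finite set \<open>M\<close>. Within a pass, the
  inner loop redirects an edge leaving \<open>b\<close> to leave \<open>a \<noteq> b\<close> instead, so the number of edges
  leaving \<open>b\<close> strictly decreases. The execution therefore descends lexicographically in the number
  of marked nodes, the program point, and the out-degree of \<open>b\<close>.
\<close>

text \<open>Execution invariant. \<open>a \<noteq> b\<close> serves the inner loop only;
  \<open>b \<in> M\<close> is carried on to \<open>Unmark\<close>, where it forces
  \<open>card M\<close> to drop.\<close>

fun wf_config :: "'a config \<Rightarrow> bool" where
  "wf_config (Start V N P) \<longleftrightarrow> finite N \<and> finite P"
| "wf_config (Outer V N P M) \<longleftrightarrow> finite P \<and> finite M"
| "wf_config (Inner V N P M a b) \<longleftrightarrow> finite P \<and> finite M \<and> a \<noteq> b \<and> b \<in> M"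
| "wf_config (Remove_Node V N P M a b) \<longleftrightarrow> finite P \<and> finite M \<and> b \<in> M"
| "wf_config (Contract_Edge V N P M a b) \<longleftrightarrow> finite P \<and> finite M \<and> b \<in> M"
| "wf_config (Unmark V N P M a b) \<longleftrightarrow> finite P \<and> finite M \<and> b \<in> M"
| "wf_config (Return V N P) \<longleftrightarrow> True"

text \<open>The value at \<open>Start\<close> anticipates the initial \<open>M\<close>, so
  initialization leaves it unchanged; the value 0 at \<open>Return\<close> can never be an
  increase.\<close>

fun marked_count :: "'a config \<Rightarrow> nat" where
  "marked_count (Start V N P) = card (ordinary_nodes V N P)"
| "marked_count (Outer V N P M) = card M"
| "marked_count (Inner V N P M a b) = card M"
| "marked_count (Remove_Node V N P M a b) = card M"
| "marked_count (Contract_Edge V N P M a b) = card M"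
| "marked_count (Unmark V N P M a b) = card M"
| "marked_count (Return V N P) = 0"

text \<open>Falls along each pass; its rise from \<open>Unmark\<close> back to \<open>Outer\<close>
  is paid for by \<open>marked_count\<close>.\<close>

fun phase :: "'a config \<Rightarrow> nat" where
  "phase (Start V N P) = 5"
| "phase (Outer V N P M) = 4"
| "phase (Inner V N P M a b) = 3"
| "phase (Remove_Node V N P M a b) = 2"
| "phase (Contract_Edge V N P M a b) = 1"
| "phase (Unmark V N P M a b) = 0"
| "phase (Return V N P) = 0"

fun inner_out_degree :: "'a config \<Rightarrow> nat" where
  "inner_out_degree (Inner V N P M a b) = card (P `` {b})"
| "inner_out_degree _ = 0"

definition config_order :: "('a config \<times> 'a config) set" where
  "config_order = measures [marked_count, phase, inner_out_degree]"

lemma wf_config_order: "wf config_order"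
  by (simp add: config_order_def)

lemma wf_config_step:
  assumes "abstract_C_step s t" "wf_config s"
  shows "wf_config t"
  using assms by cases (auto simp: ordinary_nodes_def)

lemma card_out_redirect_less:
  assumes "finite P" "a \<noteq> b" "(b, c) \<in> P"
  shows "card (((P - {(b, c)}) \<union> {(a, c)}) `` {b}) < card (P `` {b})"
proof -
  \<comment> \<open>The added edge starts at \<open>a \<noteq> b\<close>, so it cannot restore
    \<open>c\<close> as a successor of \<open>b\<close>, even if \<open>c\<close> is
    \<open>a\<close> or \<open>b\<close>.\<close>
  have "((P - {(b, c)}) \<union> {(a, c)}) `` {b} = P `` {b} - {c}"
    using assms(2) by auto
  moreover have "c \<in> P `` {b}" "finite (P `` {b})"
    using assms(1,3) by (auto intro: finite_Image)
  ultimately show ?thesis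
    by (simp only: card_Diff1_less)
qed

lemma step_decreases:
  assumes "abstract_C_step s t" "wf_config s"
  shows "(t, s) \<in> config_order"
  using assms
proof cases
  case (inner_iterate b c P V N M a)
  then show ?thesis
    using assms(2) card_out_redirect_less[of P a b c] by (simp add: config_order_def)
next
  case (unmark V N P M a b)
  then have "card (M - {b}) < card M"
    using assms(2) by (intro card_Diff1_less) simp_all
  then show ?thesis
    using unmark by (simp add: config_order_def)
\<comment> \<open>Every other step lowers \<open>phase\<close> without raising
  \<open>marked_count\<close>.\<close>
qed (auto simp: config_order_def)

text \<open>At both loop heads the guards of entry and exit are complementary; every other point
  except \<open>Return\<close> has an unconditional step.\<close>

lemma stuck_imp_returned:
  assumes "\<nexists>u. abstract_C_step t u"
  shows "returned t"
proof (cases t)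
  case (Outer V N P M)
  then show ?thesis
    using assms outer_enter[of _ M _ P V N] outer_exit[of M P V N] by blast
next
  case (Inner V N P M a b)
  then show ?thesis
    using assms inner_iterate[of b _ P V N M a] inner_exit[of b P V N M a] by blast
qed (use assms in \<open>auto intro: abstract_C_step.intros\<close>)

lemma no_infinite_execution:
  assumes "wf_config (f 0)"
  shows "\<not> (\<forall>i. abstract_C_step (f i) (f (Suc i)))"
proof
  assume steps: "\<forall>i. abstract_C_step (f i) (f (Suc i))"
  have "wf_config (f i)" for i
    by (induction i) (use assms steps wf_config_step in blast)+
  then have "\<forall>i. (f (Suc i), f i) \<in> config_order"
    using steps step_decreases by blast
  then show False
    using wf_config_order unfolding wf_iff_no_infinite_down_chain by blast
qed

theorem theorem5:
  fixes V N :: "'a set" and P :: "('a \<times> 'a) set"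
  assumes "abstract_component_C V N P"
  shows "always_terminates abstract_C_step returned (Start V N P)"
proof -
  interpret abstract_component_C V N P by fact
  have "finite P"
    using finite_subset[OF edges] finite_variables finite_nodes by blast
  then have "wf_config (Start V N P)"
    using finite_nodes by simp
  then show ?thesis
    unfolding always_terminates_def
    using no_infinite_execution stuck_imp_returned by metis
qed

end
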